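(* Consider a quantum plant that is a physically realizable annihilation operator only system $$da = F_1 a\,dt + G_1\,d\mathcal{A},\qquad d\mathcal{Y} = H_1 a\,dt + K_1\,d\mathcal{A},$$ with $F_1\in\mathbb{C}^{n\times n}$, $G_1\in\mathbb{C}^{n\times m}$, $H_1\in\mathbb{C}^{m\times n}$, $K_1\in\mathbb{C}^{m\times m}$, and let $z = C\begin{bmatrix} a\\ a^{\#}\end{bmatrix}$ with $C\in\mathbb{C}^{1\times 2n}$ be the quantity to be estimated. Let $\bar J_c$ be the cost of the purely-classical estimation scheme for this plant (homodyne detection of $\mathcal{Y}$ at angles $\theta_1,\dots,\theta_m$, followed by the optimal classical estimator). Let $\tilde J_c$ be the cost of a coherent-classical estimation scheme without coherent feedback for this plant, in which $\mathcal{Y}$ drives a coherent controller $$\begin{bmatrix} da_c\\ da_c^{\#}\end{bmatrix} = F_c\begin{bmatrix} a_c\\ a_c^{\#}\end{bmatrix}dt + G_c\begin{bmatrix} d\mathcal{Y}\\ d\mathcal{Y}^{\#}\end{bmatrix},\qquad \begin{bmatrix} d\tilde{\mathcal{Y}}\\ d\tilde{\mathcal{Y}}^{\#}\end{bmatrix} = H_c\begin{bmatrix} a_c\\ a_c^{\#}\end{bmatrix}dt + K_c\begin{bmatrix} d\mathcal{Y}\\ d\mathcal{Y}^{\#}\end{bmatrix},$$ whose output $\tilde{\mathcal{Y}}$ is homodyne detected at angles $\tilde\theta_1,\dots,\tilde\theta_{\tilde m}$ and followed by the optimal classical estimator. (Both costs are defined through algebraic Riccati equations in the context.) Then $$\tilde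 J_c = \bar J_c .$$
   Context: **Notation.** $X^{\#}$ is the entrywise complex conjugate of a complex matrix (entrywise operator adjoint for a vector of operators), $X^T$ the transpose, $X^\dagger = (X^{\#})^T$. $\Delta(X_1,X_2)=\begin{bmatrix} X_1 & X_2\\ X_2^{\#} & X_1^{\#}\end{bmatrix}$. $\iota=\sqrt{-1}$. $a=[a_1\ \cdots\ a_n]^T$ is the vector of annihilation operators of the plant, $a_c$ the vector of annihilation operators of the controller, $\mathcal{A}$ a vector of $m$ quantum noise fields, $\mathcal{Y}$ the plant output field, $\tilde{\mathcal{Y}}$ the controller output field. **Linear quantum systems.** A linear quantum system is described by linear quantum stochastic differential equations in the doubled-up variables $\begin{bmatrix} a\\ a^{\#}\end{bmatrix}$, $\begin{bmatrix} \mathcal{A}\\ \mathcal{A}^{\#}\end{bmatrix}$, with all coefficient matrices of the form $\Delta(\cdot,\cdot)$. The coherent controller is such a system. An annihilation operator only system is one in which the second arguments of all the $\Delta$'s vanish. In doubled-up form the plant is therefore $$\begin{bmatrix} da\\ da^{\#}\end{bmatrix} = F\begin{bmatrix} a\\ a^{\#}\end{bmatrix}dt + G\begin{bmatrix} d\mathcal{A}\\ d\mathcal{A}^{\#}\end{bmatrix},\qquad \begin{bmatrix} d\mathcal{Y}\\ d\mathcal{Y}^{\#}\end{bmatrix} = H\begin{bmatrix} a\\ a^{\#}\end{bmatrix}dt + K\begin{bmatrix} d\mathcal{A}\\ d\mathcal{A}^{\#}\end{bmatrix},$$ $F=\Delta(F_1,0)$, $G=\Delta(G_1,0)$, $H=\Delta(H_1,0)$,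 $K=\Delta(K_1,0)$. **Physical realizability (annihilation operator only system).** The system $(F_1,G_1,H_1,K_1)$ is physically realizable iff there is a complex commutation matrix $\Theta_1=\Theta_1^\dagger>0$ (with $\Theta_1=[a,a^\dagger]$) such that $F_1\Theta_1+\Theta_1F_1^\dagger+G_1G_1^\dagger=0$, $G_1=-\Theta_1H_1^\dagger$, $K_1=I$. **Standing assumptions.** The quantum noise is purely canonical, $d\mathcal{A}\,d\mathcal{A}^\dagger = I\,dt$; $K=I$ and $K_c=I$ (so $\tilde m=m$). **Homodyne detection.** Measuring $\mathcal{Y}$ at angles $\theta_1,\dots,\theta_m$ gives classical signals $dy_i=\tfrac12 e^{-\iota\theta_i}d\mathcal{Y}_i+\tfrac12 e^{\iota\theta_i}d\mathcal{Y}_i^{*}$, i.e. $dy = L\begin{bmatrix} d\mathcal{Y}\\ d\mathcal{Y}^{\#}\end{bmatrix}$ with $L=[L_1\ \ L_2]$, $L_1=\tfrac12\mathrm{diag}(e^{-\iota\theta_1},\dots,e^{-\iota\theta_m})$, $L_2=\tfrac12\mathrm{diag}(e^{\iota\theta_1},\dots,e^{\iota\theta_m})$. Measuring $\tilde{\mathcal{Y}}$ gives $d\tilde y=\tilde L\begin{bmatrix} d\tilde{\mathcal{Y}}\\ d\tilde{\mathcal{Y}}^{\#}\end{bmatrix}$, where $\tilde L=[\tilde L_1\ \ \tilde L_2]$ is defined in the same way with the angles $\tilde\theta_i$. **Optimal classical estimator and cost.** A classical estimator is $dx_e=F_ex_e\,dt+G_e\,dy$, $\hat z=H_ex_e$ (driven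 by $d\tilde y$ in the coherent-classical case). The optimal one minimizes the mean-square error $\lim_{t\to\infty}\langle e^*(t)e(t)\rangle$, $e=z-\hat z$, where $\langle\cdot\rangle$ is the quantum expectation over the joint quantum-classical system. It is given by the standard (complex) Kalman filter for the measured system. For a system with matrices $(F_a,G_a,H_a,K_a)$ and measurement matrix $M$ it is obtained from the solution $P$ to the algebraic Riccati equation $$F_aP+PF_a^\dagger+G_aG_a^\dagger-(G_aK_a^\dagger+PH_a^\dagger)M^\dagger(MK_aK_a^\dagger M^\dagger)^{-1}M(G_aK_a^\dagger+PH_a^\dagger)^\dagger=0 .$$ - *Purely-classical scheme:* $(F_a,G_a,H_a,K_a)=(F,G,H,I)$, $M=L$, solution $\bar P_e$; the cost is $\bar J_c=C\bar P_eC^\dagger$. - *Coherent-classical scheme (no feedback):* $$F_a=\begin{bmatrix} F&0\\ G_cH&F_c\end{bmatrix},\quad G_a=\begin{bmatrix} G\\ G_cK\end{bmatrix},\quad H_a=[K_cH\ \ H_c],\quad K_a=K_cK=I,\quad M=\tilde L,$$ solution $\tilde P_e=\begin{bmatrix} P_1&P_2\\ P_2^\dagger&P_3\end{bmatrix}$ with $P_1$ of the same size $2n\times 2n$ as $\bar P_e$; the cost is $\tilde J_c=[C\ \ 0]\,\tilde P_e\,[C\ \ 0]^\dagger=CP_1C^\dagger$. *)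

theory Defs
  imports "HOL-Analysis.Analysis"
begin

section \<open>Complex matrices and block matrices\<close>

definition mconj :: "complex^'c^'r \<Rightarrow> complex^'c^'r" where
  "mconj X = (\<chi> i j. cnj (X $ i $ j))"

definition dagger :: "complex^'c^'r \<Rightarrow> complex^'r^'c" where
  "dagger X = transpose (mconj X)"

text \<open>Block matrices are indexed by sum types: \<open>Inl\<close> indexes the first block of rows (columns),
  \<open>Inr\<close> the second.\<close>

definition hcat :: "'a^'p^'r \<Rightarrow> 'a^'q^'r \<Rightarrow> 'a^('p + 'q)^'r" where
  "hcat A B = (\<chi> i j. case j of Inl k \<Rightarrow> A $ i $ k | Inr k \<Rightarrow> B $ i $ k)"

definition vcat :: "'a^'c^'r \<Rightarrow> 'a^'c^'s \<Rightarrow> 'a^'c^('r + 's)" where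
  "vcat A B = (\<chi> i. case i of Inl k \<Rightarrow> A $ k | Inr k \<Rightarrow> B $ k)"

definition block_mat ::
    "'a^'p^'r \<Rightarrow> 'a^'q^'r \<Rightarrow> 'a^'p^'s \<Rightarrow> 'a^'q^'s \<Rightarrow> 'a^('p + 'q)^('r + 's)" where
  "block_mat A B C D = vcat (hcat A B) (hcat C D)"

definition Delta :: "complex^'c^'r \<Rightarrow> complex^'c^'r \<Rightarrow> complex^('c + 'c)^('r + 'r)" where
  "Delta X1 X2 = block_mat X1 X2 (mconj X2) (mconj X1)"

definition hermitian :: "complex^'n^'n \<Rightarrow> bool" where
  "hermitian X \<longleftrightarrow> dagger X = X"

text \<open>For Hermitian \<open>X\<close> the form \<open>v\<^sup>\<dagger> X v\<close> is real, so taking the real part loses nothing.\<close>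

definition pos_def :: "complex^'n^'n \<Rightarrow> bool" where
  "pos_def X \<longleftrightarrow>
     hermitian X \<and> (\<forall>v. v \<noteq> 0 \<longrightarrow> 0 < Re (\<Sum>i\<in>UNIV. cnj (v $ i) * (X *v v) $ i))"

definition hurwitz :: "complex^'n^'n \<Rightarrow> bool" where
  "hurwitz A \<longleftrightarrow> (\<forall>\<mu> v. v \<noteq> 0 \<and> A *v v = \<mu> *s v \<longrightarrow> Re \<mu> < 0)"


section \<open>Physical realizability and homodyne detection\<close>

definition physically_realizable_annihilation ::
    "complex^'n^'n \<Rightarrow> complex^'m^'n \<Rightarrow> complex^'n^'m \<Rightarrow> complex^'m^'m \<Rightarrow> bool" where
  "physically_realizable_annihilation F1 G1 H1 K1 \<longleftrightarrow>
     (\<exists>\<Theta>1. pos_def \<Theta>1 \<and>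
        F1 ** \<Theta>1 + \<Theta>1 ** dagger F1 + G1 ** dagger G1 = 0 \<and>
        G1 = - (\<Theta>1 ** dagger H1) \<and>
        K1 = mat 1)"

definition diag_mat :: "complex^'m \<Rightarrow> complex^'m^'m" where
  "diag_mat d = (\<chi> i j. if i = j then d $ i else 0)"

definition homodyne :: "real^'m \<Rightarrow> complex^('m + 'm)^'m" where
  "homodyne \<theta> =
     hcat (diag_mat (\<chi> i. exp (- \<i> * complex_of_real (\<theta> $ i)) / 2))
          (diag_mat (\<chi> i. exp (\<i> * complex_of_real (\<theta> $ i)) / 2))"


section \<open>The steady-state Kalman filter and the estimation costs\<close>

text \<open>The system is \<open>dx = Fa x dt + Ga dw\<close> with output \<open>Ha x dt + Ka dw\<close>, of which \<open>M\<close> times the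
  output is measured. The matrix \<open>kalman_gain\<close> is the input matrix \<open>G\<^sub>e\<close> of the estimator, whose
  state matrix is \<open>F\<^sub>e = Fa - G\<^sub>e M Ha\<close>.\<close>

definition kalman_gain ::
    "complex^'x^'x \<Rightarrow> complex^'w^'x \<Rightarrow> complex^'x^'y \<Rightarrow> complex^'w^'y \<Rightarrow> complex^'y^'p \<Rightarrow>
     complex^'p^'x" where
  "kalman_gain P Ga Ha Ka M =
     (Ga ** dagger Ka + P ** dagger Ha) ** dagger M ** matrix_inv (M ** Ka ** dagger Ka ** dagger M)"

definition riccati_equation ::
    "complex^'x^'x \<Rightarrow> complex^'w^'x \<Rightarrow> complex^'x^'y \<Rightarrow> complex^'w^'y \<Rightarrow> complex^'y^'p \<Rightarrow>
     complex^'x^'x \<Rightarrow> bool" where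
  "riccati_equation Fa Ga Ha Ka M P \<longleftrightarrow>
     Fa ** P + P ** dagger Fa + Ga ** dagger Ga
       - (Ga ** dagger Ka + P ** dagger Ha) ** dagger M
           ** matrix_inv (M ** Ka ** dagger Ka ** dagger M)
           ** M ** dagger (Ga ** dagger Ka + P ** dagger Ha) = 0"

text \<open>The Riccati equation alone does not determine \<open>P\<close>, not even among positive semidefinite
  matrices. As usual for the steady-state Kalman filter, \<open>P\<close> is the Hermitian stabilizing solution,
  i.e. the one for which the state matrix of the estimator is Hurwitz. That solution is unique and
  automatically positive semidefinite.\<close>

definition kalman_solution ::
    "complex^'x^'x \<Rightarrow> complex^'w^'x \<Rightarrow> complex^'x^'y \<Rightarrow> complex^'w^'y \<Rightarrow> complex^'y^'p \<Rightarrow>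
     complex^'x^'x \<Rightarrow> bool" where
  "kalman_solution Fa Ga Ha Ka M P \<longleftrightarrow>
     hermitian P \<and> riccati_equation Fa Ga Ha Ka M P \<and>
     hurwitz (Fa - kalman_gain P Ga Ha Ka M ** M ** Ha)"

text \<open>The costs are relations (\<open>J\<close> is the cost of the scheme) because a Kalman solution need not
  exist. As \<open>C\<close> is a single row, they are \<open>1 \<times> 1\<close> matrices.\<close>

definition purely_classical_cost ::
    "complex^('n::finite + 'n)^('n::finite + 'n) \<Rightarrow> complex^('m::finite + 'm)^('n::finite + 'n) \<Rightarrow>
     complex^('n::finite + 'n)^('m::finite + 'm) \<Rightarrow> complex^('m::finite + 'm)^('m::finite + 'm) \<Rightarrow>
     complex^('n::finite + 'n)^1 \<Rightarrow> real^'m \<Rightarrow> complex^1^1 \<Rightarrow> bool" where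
  "purely_classical_cost F G H K C \<theta> J \<longleftrightarrow>
     (\<exists>P. kalman_solution F G H K (homodyne \<theta>) P \<and> J = C ** P ** dagger C)"

definition coherent_classical_cost ::
    "complex^('n::finite + 'n)^('n::finite + 'n) \<Rightarrow> complex^('m::finite + 'm)^('n::finite + 'n) \<Rightarrow>
     complex^('n::finite + 'n)^('m::finite + 'm) \<Rightarrow> complex^('m::finite + 'm)^('m::finite + 'm) \<Rightarrow>
     complex^('k::finite + 'k)^('k::finite + 'k) \<Rightarrow> complex^('m::finite + 'm)^('k::finite + 'k) \<Rightarrow>
     complex^('k::finite + 'k)^('m::finite + 'm) \<Rightarrow> complex^('m::finite + 'm)^('m::finite + 'm) \<Rightarrow>
     complex^('n::finite + 'n)^1 \<Rightarrow> real^'m \<Rightarrow> complex^1^1 \<Rightarrow> bool" where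
  "coherent_classical_cost F G H K Fc Gc Hc Kc C \<theta> J \<longleftrightarrow>
     (\<exists>P. kalman_solution (block_mat F 0 (Gc ** H) Fc) (vcat G (Gc ** K))
            (hcat (Kc ** H) Hc) (Kc ** K) (homodyne \<theta>) P \<and>
          J = hcat C 0 ** P ** dagger (hcat C 0))"

end

theory Submission
  imports Defs "HOL-Computational_Algebra.Fundamental_Theorem_Algebra"
begin

text \<open>
  Physical realizability says exactly that the commutation matrix \<open>T = Delta \<Theta>1 0\<close> solves the
  Lyapunov equation of the plant and has vanishing Kalman gain, so that measuring the output
  teaches nothing about the plant, whichever angles are used and whatever controller the output
  passes through. Concretely, let \<open>P\<close> be the Kalman solution of the system seen by the estimator,
  let \<open>R\<close> be the projection onto the plant variables (the identity in the purely classical scheme,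
  \<open>[I 0]\<close> in the coherent one), and put \<open>D = R P - T R\<close>. Subtracting the Lyapunov equation from
  the plant rows of the Riccati equation gives the Sylvester equation \<open>F D + D A\<^sup>\<dagger> = 0\<close>, where \<open>A\<close> is
  the Hurwitz state matrix of the estimator. By the Lyapunov equation \<open>F\<close> has no eigenvalue with
  positive real part, hence \<open>D = 0\<close>, and both costs are equal to \<open>C T C\<^sup>\<dagger>\<close>.
\<close>

section \<open>Polynomials in an operator and eigenvectors in invariant subspaces\<close>

definition operator_poly :: "('a::comm_ring_1^'p \<Rightarrow> 'a^'p) \<Rightarrow> 'a poly \<Rightarrow> 'a^'p \<Rightarrow> 'a^'p" where
  "operator_poly f p x = (\<Sum>i\<le>degree p. coeff p i *s (f ^^ i) x)"

lemma operator_poly_bound: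
  assumes "degree p \<le> N"
  shows "operator_poly f p x = (\<Sum>i\<le>N. coeff p i *s (f ^^ i) x)"
  unfolding operator_poly_def
  by (rule sum.mono_neutral_left) (use assms in \<open>auto simp: coeff_eq_0\<close>)

lemma operator_poly_add:
  "operator_poly f (p + q) x = operator_poly f p x + operator_poly f q x"
proof -
  define N where "N = max (degree p) (degree q)"
  have "degree (p + q) \<le> N" "degree p \<le> N" "degree q \<le> N"
    using degree_add_le_max[of p q] by (auto simp: N_def)
  then show ?thesis
    by (simp add: operator_poly_bound sum.distrib vector_sadd_rdistrib)
qed

lemma operator_poly_smult:
  fixes f :: "'a::field^'p \<Rightarrow> 'a^'p"
  shows "operator_poly f (smult c p) x = c *s operator_poly f p x"
  by (simp add: operator_poly_bound[OF degree_smult_le])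
    (simp add: operator_poly_def vec.scale_sum_right)

lemma operator_poly_shift:
  fixes f :: "'a::field^'p \<Rightarrow> 'a^'p"
  assumes "Vector_Spaces.linear (*s) (*s) f"
  shows "operator_poly f (pCons 0 p) x = f (operator_poly f p x)"
proof -
  interpret f: Vector_Spaces.linear "(*s)" "(*s)" f by fact
  have "operator_poly f (pCons 0 p) x = (\<Sum>i\<le>Suc (degree p). coeff (pCons 0 p) i *s (f ^^ i) x)"
    by (rule operator_poly_bound) (rule degree_pCons_le)
  also have "\<dots> = (\<Sum>i\<le>degree p. coeff p i *s (f ^^ Suc i) x)"
    by (subst sum.atMost_Suc_shift) (simp del: funpow.simps(2))
  also have "\<dots> = f (operator_poly f p x)"
    by (simp add: operator_poly_def f.sum f.scale)
  finally show ?thesis .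
qed

text \<open>The \<open>CARD('p) + 1\<close> vectors \<open>x, f x, f (f x), ...\<close> cannot be
  independent. If they are distinct, the coefficients of a linear dependence form \<open>p\<close>;
  dependence is a property of sets, so a repetition among them is treated separately, with the
  difference of two monomials as \<open>p\<close>.\<close>

lemma operator_poly_annihilates:
  fixes f :: "'a::field^'p \<Rightarrow> 'a^'p"
  shows "\<exists>p. p \<noteq> 0 \<and> operator_poly f p x = 0"
proof -
  define N where "N = CARD('p)"
  show ?thesis
  proof (cases "inj_on (\<lambda>i. (f ^^ i) x) {..N}")
    case inj: True
    let ?S = "(\<lambda>i. (f ^^ i) x) ` {..N}"
    have "card ?S = Suc N" using inj by (simp add: card_image)
    then have "vec.dependent ?S"
      using vec.independent_card_le_dim[of ?S UNIV] by (auto simp: N_def vec.dim_UNIV card_cart_basis)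
    then obtain u v where u: "v \<in> ?S" "u v \<noteq> 0" "(\<Sum>v\<in>?S. u v *s v) = 0"
      by (auto simp: vec.dependent_finite)
    define p where "p = (\<Sum>i\<le>N. monom (u ((f ^^ i) x)) i)"
    have c: "coeff p i = (if i \<le> N then u ((f ^^ i) x) else 0)" for i
      by (simp add: p_def coeff_sum if_distrib cong: if_cong)
    have "degree p \<le> N" by (rule degree_le) (simp add: c)
    then have "operator_poly f p x = (\<Sum>i\<le>N. u ((f ^^ i) x) *s (f ^^ i) x)"
      by (simp add: operator_poly_bound c)
    also have "\<dots> = (\<Sum>v\<in>?S. u v *s v)" by (simp add: sum.reindex[OF inj])
    finally have "operator_poly f p x = 0" using u by simp
    moreover have "p \<noteq> 0" using u c by (metis (no_types, lifting) atMost_iff coeff_0 imageE)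
    ultimately show ?thesis by blast
  next
    case False
    then obtain i j where ij: "i < j" "(f ^^ i) x = (f ^^ j) x"
      by (metis (no_types, lifting) inj_onI linorder_neqE_nat)
    define p :: "'a poly" where "p = monom 1 j - monom 1 i"
    have c: "coeff p k = (if k = j then 1 else 0) - (if k = i then 1 else 0)" for k
      by (auto simp: p_def)
    have "degree p \<le> j" by (rule degree_le) (use ij in \<open>auto simp: c\<close>)
    then have "operator_poly f p x = (\<Sum>k\<le>j. ((if k = j then 1 else 0) - (if k = i then 1 else 0)) *s (f ^^ k) x)"
      by (simp add: operator_poly_bound c)
    also have "\<dots> = (\<Sum>k\<le>j. (if k = j then (f ^^ k) x else 0)) - (\<Sum>k\<le>j. (if k = i then (f ^^ k) x else 0))"
      unfolding sum_subtractf[symmetric] by (rule sum.cong) (use ij in \<open>auto\<close>)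
    also have "\<dots> = 0" using ij by simp
    finally have "operator_poly f p x = 0" .
    moreover have "coeff p j = 1" using ij by (simp add: c)
    then have "p \<noteq> 0" by auto
    ultimately show ?thesis by blast
  qed
qed

text \<open>Take a nonzero \<open>p\<close> of least degree with \<open>p(f) x = 0\<close>, a root
  \<open>c\<close> of \<open>p\<close>, and write \<open>p = (X - c) q\<close>. By minimality
  \<open>q(f) x\<close> is nonzero, and \<open>f - c\<close> kills it, so it is the eigenvector;
  invariance keeps it in \<open>V\<close>.\<close>

lemma invariant_subspace_eigenvector:
  fixes f :: "'a::alg_closed_field^'p \<Rightarrow> 'a^'p"
  assumes f: "Vector_Spaces.linear (*s) (*s) f"
    and V: "vec.subspace V" "\<And>v. v \<in> V \<Longrightarrow> f v \<in> V"
    and x: "x \<in> V" "x \<noteq> 0"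
  obtains c v where "v \<in> V" "v \<noteq> 0" "f v = c *s v"
proof -
  define P where "P d = (\<exists>p. p \<noteq> 0 \<and> operator_poly f p x = 0 \<and> degree p = d)" for d
  have "\<exists>d. P d" using operator_poly_annihilates[of f x] by (auto simp: P_def)
  then obtain d where d: "P d" and least: "\<And>e. P e \<Longrightarrow> d \<le> e"
    by (metis LeastI_ex Least_le)
  then obtain p where p: "p \<noteq> 0" "operator_poly f p x = 0" "degree p = d"
    by (auto simp: P_def)
  have "degree p \<noteq> 0"
  proof
    assume "degree p = 0"
    then show False using p x by (auto simp: operator_poly_def elim!: degree_eq_zeroE)
  qed
  then obtain c where "poly p c = 0"
    using alg_closed_imp_poly_has_root[of p] by auto
  then obtain q where q: "p = [:-c, 1:] * q" by (auto simp: poly_eq_0_iff_dvd dvd_def)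
  have q0: "q \<noteq> 0" using p q by auto
  have "degree p = Suc (degree q)" using q q0 by (simp add: degree_mult_eq del: mult_pCons_left)
  then have ne: "operator_poly f q x \<noteq> 0" using least[of "degree q"] q0 p(3) by (auto simp: P_def)
  have "(f ^^ i) x \<in> V" for i by (induction i) (auto simp: V x)
  then have inV: "operator_poly f q x \<in> V"
    unfolding operator_poly_def by (intro vec.subspace_sum vec.subspace_scale V)
  \<comment> \<open>The product with \<open>X - c\<close> is split into a scaling and a shift, the
    operations whose effect on \<open>operator_poly\<close> is known.\<close>
  have "p = smult (- c) q + pCons 0 q" using q by simp
  then have "operator_poly f p x = - c *s operator_poly f q x + f (operator_poly f q x)"
    by (simp only: operator_poly_add operator_poly_smult operator_poly_shift[OF f])
  then have "f (operator_poly f q x) = c *s operator_poly f q x"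
    using p(2) by simp
  with inV ne that show ?thesis by simp
qed

section \<open>Matrix algebra and eigenvalues of intertwined matrices\<close>

lemma matrix_add_rdistrib: "(A + B) ** C = A ** C + B ** C"
  for A B :: "'a::semiring_1^'m^'n"
  by (simp add: vec_eq_iff matrix_matrix_mult_def distrib_right sum.distrib)

lemma matrix_diff_ldistrib: "A ** (B - C) = A ** B - A ** C"
  for A :: "'a::ring_1^'m^'n"
  by (simp add: vec_eq_iff matrix_matrix_mult_def right_diff_distrib sum_subtractf)

lemma matrix_diff_rdistrib: "(A - B) ** C = A ** C - B ** C"
  for A B :: "'a::ring_1^'m^'n"
  by (simp add: vec_eq_iff matrix_matrix_mult_def left_diff_distrib sum_subtractf)

lemma matrix_minus_left: "(- A) ** B = - (A ** B)"
  for A :: "'a::ring_1^'m^'n"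
  by (simp add: vec_eq_iff matrix_matrix_mult_def sum_negf)

lemma matrix_minus_right: "A ** (- B) = - (A ** B)"
  for A :: "'a::ring_1^'m^'n"
  by (simp add: vec_eq_iff matrix_matrix_mult_def sum_negf)

lemma matrix_zero_left [simp]: "0 ** B = (0 :: 'a::semiring_1^'k^'n)"
  by (simp add: vec_eq_iff matrix_matrix_mult_def)

lemma matrix_zero_right [simp]: "A ** 0 = (0 :: 'a::semiring_1^'k^'n)"
  by (simp add: vec_eq_iff matrix_matrix_mult_def)

lemmas matrix_ring_simps =
  matrix_add_ldistrib matrix_add_rdistrib matrix_diff_ldistrib matrix_diff_rdistrib
  matrix_minus_left matrix_minus_right matrix_mul_assoc

text \<open>The eigenvector of \<open>Z \<mapsto> A Z\<close> is taken in the space of all intertwiners \<open>Z\<close>. Matrices are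
  flattened to vectors because only those have a vector space structure over \<open>'a\<close> in the library.\<close>

lemma intertwined_common_eigenvalue:
  fixes A :: "'a::alg_closed_field^'n^'n" and B :: "'a^'m^'m" and X :: "'a^'m^'n"
  assumes AX: "A ** X = X ** B" and X: "X \<noteq> 0"
  obtains c v w where "v \<noteq> 0" "A *v v = c *s v" "w \<noteq> 0" "w v* B = c *s w"
proof -
  define M :: "'a^('n \<times> 'm) \<Rightarrow> 'a^'m^'n" where "M z = (\<chi> i j. z $ (i, j))" for z
  define f :: "'a^('n \<times> 'm) \<Rightarrow> 'a^('n \<times> 'm)" where "f z = (\<chi> p. (A ** M z) $ fst p $ snd p)" for z
  define V where "V = {z. A ** M z = M z ** B}"
  define x :: "'a^('n \<times> 'm)" where "x = (\<chi> p. X $ fst p $ snd p)"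
  have Mf: "M (f z) = A ** M z" for z by (simp add: M_def f_def vec_eq_iff)
  have Mx: "M x = X" by (simp add: M_def x_def vec_eq_iff)
  have M0: "M z = 0 \<longleftrightarrow> z = 0" for z by (auto simp: M_def vec_eq_iff)
  have M_add: "M (y + z) = M y + M z" for y z by (simp add: M_def vec_eq_iff)
  have left_scale: "(A ** M (c *s z)) $ i $ j = c * (A ** M z) $ i $ j" for c z i j
    by (simp add: M_def matrix_matrix_mult_def sum_distrib_left mult.left_commute)
  have right_scale: "(M (c *s z) ** B) $ i $ j = c * (M z ** B) $ i $ j" for c z i j
    by (simp add: M_def matrix_matrix_mult_def sum_distrib_left mult.assoc)
  have lin: "Vector_Spaces.linear (*s) (*s) f"
    by unfold_locales
      (simp_all add: f_def vec_eq_iff left_scale M_add matrix_add_ldistrib algebra_simps)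
  have M_0: "M 0 = 0" by (simp add: M_def vec_eq_iff)
  have sub: "vec.subspace V"
    unfolding vec.subspace_def V_def mem_Collect_eq
    by (simp add: M_0 M_add matrix_add_ldistrib matrix_add_rdistrib)
      (simp add: vec_eq_iff left_scale right_scale)
  have inv: "f z \<in> V" if "z \<in> V" for z
    using that by (auto simp: V_def Mf matrix_mul_assoc)
  have "x \<in> V" "x \<noteq> 0" using AX X M0[of x] by (auto simp: V_def Mx)
  then obtain c z where z: "z \<in> V" "z \<noteq> 0" "f z = c *s z"
    using invariant_subspace_eigenvector[OF lin sub inv] by metis
  have Z: "(A ** M z) $ i $ j = c * M z $ i $ j" for i j
    unfolding Mf[symmetric] z(3) by (simp add: M_def)
  \<comment> \<open>With \<open>Z = M z\<close>, the chain \<open>A Z = c Z = Z B\<close> makes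
    every nonzero column of \<open>Z\<close> a right eigenvector of \<open>A\<close> and every
    nonzero row a left eigenvector of \<open>B\<close>. A nonzero entry selects one of each.\<close>
  have "M z \<noteq> 0" using z M0 by blast
  then obtain i j where ij: "M z $ i $ j \<noteq> 0" by (auto simp: vec_eq_iff)
  show ?thesis
  proof
    show "column j (M z) \<noteq> 0" "row i (M z) \<noteq> 0"
      using ij by (auto simp: column_def row_def vec_eq_iff)
    show "A *v column j (M z) = c *s column j (M z)"
      using Z by (simp add: vec_eq_iff column_def matrix_vector_mult_def matrix_matrix_mult_def)
    have "(M z ** B) $ i $ j = c * M z $ i $ j" for i j
      using Z z(1) by (simp add: V_def)
    then show "row i (M z) v* B = c *s row i (M z)"
      by (simp add: vec_eq_iff row_def vector_matrix_mult_def matrix_matrix_mult_def mult.commute)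
  qed
qed

section \<open>Conjugate transposes and the homogeneous Sylvester equation\<close>

lemma dagger_nth [simp]: "dagger X $ i $ j = cnj (X $ j $ i)"
  by (simp add: dagger_def mconj_def transpose_def)

lemma dagger_dagger [simp]: "dagger (dagger X) = X"
  by (simp add: vec_eq_iff)

lemma dagger_zero [simp]: "dagger 0 = 0"
  by (simp add: vec_eq_iff)

lemma dagger_mat [simp]: "dagger (mat c) = mat (cnj c)"
  by (auto simp: vec_eq_iff mat_def)

lemma dagger_add: "dagger (X + Y) = dagger X + dagger Y"
  by (simp add: vec_eq_iff)

lemma dagger_diff: "dagger (X - Y) = dagger X - dagger Y"
  by (simp add: vec_eq_iff)

lemma dagger_mult: "dagger (X ** Y) = dagger Y ** dagger X"
  by (simp add: vec_eq_iff matrix_matrix_mult_def mult.commute)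

text \<open>A nonzero \<open>X\<close> would intertwine \<open>A\<close> with
  \<open>- dagger B\<close>, giving them a common eigenvalue \<open>c\<close>. Conjugating the left
  eigenvector of \<open>- dagger B\<close> yields an eigenvector of \<open>B\<close> for
  \<open>- cnj c\<close>, so the Hurwitz property forces \<open>Re c > 0\<close>, against the bound
  on the spectrum of \<open>A\<close>.\<close>

lemma sylvester_trivial_kernel:
  fixes A :: "complex^'n^'n" and B :: "complex^'m^'m" and X :: "complex^'m^'n"
  assumes eq: "A ** X + X ** dagger B = 0"
    and A: "\<And>c v. v \<noteq> 0 \<Longrightarrow> A *v v = c *s v \<Longrightarrow> Re c \<le> 0"
    and B: "hurwitz B"
  shows "X = 0"
proof (rule ccontr)
  assume "X \<noteq> 0"
  have "A ** X = X ** (- dagger B)"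
    using eq by (simp add: matrix_minus_right add_eq_0_iff2)
  from intertwined_common_eigenvalue[OF this \<open>X \<noteq> 0\<close>]
  obtain c v w where v: "v \<noteq> 0" "A *v v = c *s v" and w: "w \<noteq> 0" "w v* (- dagger B) = c *s w"
    by blast
  define u where "u = (\<chi> i. cnj (w $ i))"
  have "B *v u = (- cnj c) *s u"
  proof -
    have "(\<Sum>j\<in>UNIV. cnj (B $ i $ j) * w $ j) = - (c * w $ i)" for i
      using w(2) by (simp add: vec_eq_iff vector_matrix_mult_def sum_negf mult.commute)
        (metis add.inverse_inverse)
    then have "cnj (\<Sum>j\<in>UNIV. cnj (B $ i $ j) * w $ j) = cnj (- (c * w $ i))" for i
      by simp
    then show ?thesis
      by (simp add: vec_eq_iff matrix_vector_mult_def u_def cnj_sum)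
  qed
  moreover have "u \<noteq> 0" using w(1) by (auto simp: u_def vec_eq_iff)
  ultimately have "Re (- cnj c) < 0" using B unfolding hurwitz_def by blast
  moreover have "Re c \<le> 0" using A v by blast
  ultimately show False by simp
qed

section \<open>Positive definite solutions of the Lyapunov equation\<close>

definition cdot :: "complex^'n \<Rightarrow> complex^'n \<Rightarrow> complex" where
  "cdot x y = (\<Sum>i\<in>UNIV. cnj (x $ i) * y $ i)"

lemma cdot_adjoint: "cdot x (A *v y) = cdot (dagger A *v x) y"
proof -
  have "cdot x (A *v y) = (\<Sum>i\<in>UNIV. \<Sum>j\<in>UNIV. cnj (x $ i) * A $ i $ j * y $ j)"
    by (simp add: cdot_def matrix_vector_mult_def sum_distrib_left mult.assoc)
  also have "\<dots> = (\<Sum>j\<in>UNIV. \<Sum>i\<in>UNIV. cnj (x $ i) * A $ i $ j * y $ j)"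
    by (rule sum.swap)
  also have "\<dots> = cdot (dagger A *v x) y"
    by (simp add: cdot_def matrix_vector_mult_def sum_distrib_left cnj_sum mult.commute)
  finally show ?thesis .
qed

lemma cdot_self_nonneg: "0 \<le> Re (cdot x x)"
  by (auto simp: cdot_def intro!: sum_nonneg)

lemma pos_def_iff_cdot:
  "pos_def X \<longleftrightarrow> hermitian X \<and> (\<forall>v. v \<noteq> 0 \<longrightarrow> 0 < Re (cdot v (X *v v)))"
  by (simp add: pos_def_def cdot_def)

lemma pos_def_surj:
  assumes "pos_def X"
  obtains y where "X *v y = v"
proof -
  have "X *v y = 0 \<Longrightarrow> y = 0" for y
    using assms by (force simp: pos_def_iff_cdot cdot_def)
  then obtain Y where "Y ** X = mat 1" using matrix_left_invertible_ker by blast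
  then have "X ** Y = mat 1" using matrix_left_right_inverse by blast
  then have "X *v (Y *v v) = v" by (simp add: matrix_vector_mul_assoc)
  then show ?thesis using that by blast
qed

text \<open>The equation is tested on the preimage \<open>y\<close> of \<open>v\<close> under
  \<open>T\<close>, so that \<open>A ** T\<close> meets the eigenvector. This gives
  \<open>2 * Re c * s + g = 0\<close>, where \<open>s\<close> is the value at \<open>y\<close> of
  the positive form of \<open>T\<close> and \<open>g\<close> is the squared norm of
  \<open>dagger G *v y\<close>.\<close>

lemma lyapunov_eigenvalue:
  fixes A T :: "complex^'n^'n"
  assumes T: "pos_def T" and eq: "A ** T + T ** dagger A + G ** dagger G = 0"
    and v: "v \<noteq> 0" "A *v v = c *s v"
  shows "Re c \<le> 0"
proof -
  obtain y where y: "T *v y = v" using pos_def_surj[OF T] .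
  have dT: "dagger T = T" using T by (simp add: pos_def_def hermitian_def)
  have "y \<noteq> 0" using v y by auto
  then have s: "0 < Re (cdot y v)" using T y by (auto simp: pos_def_iff_cdot)
  have sym: "cdot v y = cdot y v"
    using cdot_adjoint[of y T y] by (simp add: dT y)
  have "cdot y ((A ** T + T ** dagger A + G ** dagger G) *v y) = 0"
    by (simp add: eq cdot_def)
  moreover have "cdot y ((A ** T) *v y) = c * cdot y v"
    by (simp add: y v(2) flip: matrix_vector_mul_assoc)
      (simp add: cdot_def sum_distrib_left mult.left_commute)
  \<comment> \<open>The adjoint \<open>A ** T\<close> moves to the first argument, where it maps
    \<open>y\<close> to \<open>c *s v\<close> and the scalar comes out conjugated.\<close>
  moreover have "cdot y ((T ** dagger A) *v y) = cnj c * cdot y v"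
    by (simp add: y v(2) dT cdot_adjoint dagger_mult flip: matrix_vector_mul_assoc sym)
      (simp add: cdot_def sum_distrib_left mult.assoc)
  moreover have "cdot y ((G ** dagger G) *v y) = cdot (dagger G *v y) (dagger G *v y)"
    by (simp add: cdot_adjoint flip: matrix_vector_mul_assoc)
  moreover have "cdot y (p + q) = cdot y p + cdot y q" for p q
    by (simp add: cdot_def sum.distrib ring_distribs)
  ultimately have "c * cdot y v + cnj c * cdot y v + cdot (dagger G *v y) (dagger G *v y) = 0"
    by (simp add: matrix_vector_mult_add_rdistrib)
  then have "Re (c * cdot y v + cnj c * cdot y v + cdot (dagger G *v y) (dagger G *v y)) = 0"
    by simp
  then have "2 * Re c * Re (cdot y v) + Re (cdot (dagger G *v y) (dagger G *v y)) = 0"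
    by simp
  with cdot_self_nonneg[of "dagger G *v y"] have "Re c * Re (cdot y v) \<le> 0" by linarith
  with s show ?thesis by (simp add: mult_le_0_iff)
qed

section \<open>Block matrices and the homodyne measurement matrix\<close>

lemma sum_sum_type: "(\<Sum>i\<in>UNIV. g i) = (\<Sum>i\<in>UNIV. g (Inl i)) + (\<Sum>i\<in>UNIV. g (Inr i))"
  for g :: "'a::finite + 'b::finite \<Rightarrow> 'c::comm_monoid_add"
  by (simp add: sum.Plus comp_def flip: UNIV_Plus_UNIV)

lemma hcat_nth [simp]:
  "hcat A B $ i $ Inl k = A $ i $ k" "hcat A B $ i $ Inr l = B $ i $ l"
  by (simp_all add: hcat_def)

lemma vcat_nth [simp]: "vcat A B $ Inl k = A $ k" "vcat A B $ Inr l = B $ l"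
  by (simp_all add: vcat_def)

lemma hcat_zero [simp]: "hcat 0 0 = (0 :: 'a::zero^('p::finite + 'q::finite)^'r)"
  by (simp add: vec_eq_iff split_sum_all)

lemma hcat_mult_vcat: "hcat A B ** vcat C D = A ** C + B ** D"
  by (simp add: vec_eq_iff matrix_matrix_mult_def sum_sum_type)

lemma mult_hcat: "X ** hcat A B = hcat (X ** A) (X ** B)"
  by (simp add: vec_eq_iff split_sum_all matrix_matrix_mult_def)

lemma vcat_mult: "vcat A B ** X = vcat (A ** X) (B ** X)"
  by (simp add: vec_eq_iff split_sum_all matrix_matrix_mult_def)

lemma dagger_hcat: "dagger (hcat A B) = vcat (dagger A) (dagger B)"
  by (simp add: vec_eq_iff split_sum_all)

lemma vcat_add: "vcat A B + vcat C D = vcat (A + C) (B + D)"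
  by (simp add: vec_eq_iff split_sum_all)

lemma vcat_diff: "vcat A B - vcat C D = vcat (A - C) (B - D)"
  by (simp add: vec_eq_iff split_sum_all)

lemma hcat_add: "hcat A B + hcat C D = hcat (A + C) (B + D)"
  by (simp add: vec_eq_iff split_sum_all)

lemma block_mat_mult:
  "block_mat A B C D ** block_mat A' B' C' D' =
     block_mat (A ** A' + B ** C') (A ** B' + B ** D') (C ** A' + D ** C') (C ** B' + D ** D')"
  by (simp only: block_mat_def vcat_mult hcat_mult_vcat mult_hcat hcat_add)

lemma diag_mat_mult_dagger: "diag_mat d ** dagger (diag_mat d) = diag_mat (\<chi> i. d $ i * cnj (d $ i))"
proof -
  have "(diag_mat d ** dagger (diag_mat d)) $ i $ j = diag_mat (\<chi> i. d $ i * cnj (d $ i)) $ i $ j" for i j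
  proof -
    have "(diag_mat d ** dagger (diag_mat d)) $ i $ j
      = (\<Sum>k\<in>UNIV. if k = i then (if j = i then d $ i * cnj (d $ i) else 0) else 0)"
      unfolding matrix_matrix_mult_def vec_lambda_beta dagger_nth
      by (rule sum.cong) (auto simp: diag_mat_def)
    then show ?thesis by (auto simp: diag_mat_def)
  qed
  then show ?thesis by (simp add: vec_eq_iff)
qed

text \<open>The diagonal entries of both blocks have modulus 1/2, so the phases cancel and the
  blocks contribute 1/4 each.\<close>

lemma homodyne_mult_dagger: "homodyne \<theta> ** dagger (homodyne \<theta>) = mat (1/2)"
proof -
  have e: "exp (- (\<i> * complex_of_real t)) * exp (\<i> * complex_of_real t) = 1" for t
    by (simp flip: exp_add)
  then have e': "exp (\<i> * complex_of_real t) * exp (- (\<i> * complex_of_real t)) = 1" for t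
    by (simp add: mult.commute)
  show ?thesis
    unfolding homodyne_def dagger_hcat hcat_mult_vcat diag_mat_mult_dagger
    by (simp add: vec_eq_iff diag_mat_def mat_def exp_cnj e e')
qed

lemma matrix_inv_unique:
  fixes A B :: "'a::field^'n^'n"
  assumes "A ** B = mat 1"
  shows "matrix_inv A = B"
proof -
  have "B ** A = mat 1" using assms matrix_left_right_inverse by blast
  then have "matrix_inv A ** A = mat 1"
    unfolding matrix_inv_def using assms by (metis (mono_tags, lifting) someI)
  then have "matrix_inv A ** (A ** B) = B" by (simp add: matrix_mul_assoc)
  then show ?thesis by (simp add: assms)
qed

section \<open>Plant block of the Kalman solution\<close>

text \<open>Both schemes are instances, with \<open>R\<close> the identity or \<open>[I 0]\<close>.
  The last condition on \<open>R\<close> expresses that the controller sees the plant only through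
  its output: in the coherent scheme \<open>Ga - dagger R ** G\<close> is the column of
  \<open>0\<close> and \<open>Gc\<close>, and multiplying it by \<open>H\<close> gives the coupling
  block \<open>Gc ** H\<close> of \<open>Fa\<close>. For the identity it is zero.\<close>

lemma kalman_solution_compression:
  fixes F T :: "complex^'n^'n" and G :: "complex^'w^'n" and H :: "complex^'n^'w"
    and Fa P :: "complex^'x^'x" and Ga :: "complex^'w^'x" and Ha :: "complex^'x^'w"
    and R :: "complex^'x^'n" and M :: "complex^'w^'p"
  assumes T: "pos_def T" "F ** T + T ** dagger F + G ** dagger G = 0" "G = - (T ** dagger H)"
    and R: "R ** dagger R = mat 1" "R ** Fa = F ** R" "R ** Ga = G" "Ha ** dagger R = H"
      "Fa ** dagger R = dagger R ** F + (Ga - dagger R ** G) ** H"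
    and M: "dagger (matrix_inv (M ** dagger M)) = matrix_inv (M ** dagger M)"
    and P: "kalman_solution Fa Ga Ha (mat 1) M P"
  shows "R ** P ** dagger R = T"
proof -
  define W where "W = Ga + P ** dagger Ha"
  \<comment> \<open>With this weight the Kalman gain times \<open>M\<close> is
    \<open>W ** N\<close>, and the quadratic Riccati term is
    \<open>W ** N ** dagger W\<close>.\<close>
  define N where "N = dagger M ** matrix_inv (M ** dagger M) ** M"
  define D where "D = R ** P - T ** R"
  define A where "A = Fa - W ** N ** Ha"
  have "hurwitz A"
    using P by (simp add: kalman_solution_def kalman_gain_def A_def W_def N_def matrix_mul_assoc)
  have dN: "dagger N = N" by (simp add: N_def dagger_mult M matrix_mul_assoc)
  have riccati: "Fa ** P + P ** dagger Fa + Ga ** dagger Ga - W ** N ** dagger W = 0"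
    using P by (simp add: kalman_solution_def riccati_equation_def W_def N_def matrix_mul_assoc)
  have TH: "T ** dagger H = - G" using T(3) by simp
  have RHa: "R ** dagger Ha = dagger H"
    using arg_cong[OF R(4), of dagger] by (simp add: dagger_mult)
  have RFa: "R ** dagger Fa = dagger F ** R + dagger H ** (dagger Ga - dagger G ** R)"
    using arg_cong[OF R(5), of dagger] by (simp add: dagger_mult dagger_add dagger_diff)
  have TRHa: "T ** R ** dagger Ha = - G"
    by (simp add: RHa TH flip: matrix_mul_assoc)
  \<comment> \<open>The vanishing plant gain of \<open>T\<close> enters here:
    \<open>- T ** R ** dagger Ha\<close> supplies exactly the \<open>G\<close> in
    \<open>R ** W\<close>. This later turns the quadratic term into a part of
    \<open>D ** dagger A\<close>.\<close>
  have DHa: "D ** dagger Ha = R ** W"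
    by (simp add: D_def W_def matrix_ring_simps R(3) TRHa)
  have "R ** (Fa ** P + P ** dagger Fa + Ga ** dagger Ga - W ** N ** dagger W) = 0"
    by (simp add: riccati)
  then have one: "F ** R ** P + R ** P ** dagger Fa + G ** dagger Ga - R ** W ** N ** dagger W = 0"
    by (simp add: matrix_ring_simps R(2,3))
  have "T ** R ** dagger Fa = T ** dagger F ** R + T ** dagger H ** (dagger Ga - dagger G ** R)"
    unfolding matrix_mul_assoc[symmetric] RFa by (simp add: matrix_ring_simps)
  also have "\<dots> = T ** dagger F ** R - G ** dagger Ga + G ** dagger G ** R"
    by (simp add: TH matrix_ring_simps)
  finally have TRFa: "T ** R ** dagger Fa = T ** dagger F ** R - G ** dagger Ga + G ** dagger G ** R" .
  \<comment> \<open>By \<open>TRFa\<close>, replacing \<open>T ** dagger F ** R\<close> by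
    \<open>T ** R ** dagger Fa\<close> also replaces \<open>G ** dagger G ** R\<close> by
    \<open>G ** dagger Ga\<close>, the noise term of the plant rows in \<open>one\<close>.\<close>
  have "(F ** T + T ** dagger F + G ** dagger G) ** R = 0" by (simp add: T(2))
  then have two: "F ** T ** R + T ** R ** dagger Fa + G ** dagger Ga = 0"
    by (simp add: matrix_ring_simps TRFa add.assoc)
  have "D ** dagger A = D ** dagger Fa - D ** dagger Ha ** N ** dagger W"
    by (simp add: A_def dagger_diff dagger_mult dN matrix_ring_simps)
  then have "F ** D + D ** dagger A = F ** R ** P - F ** T ** R
      + (R ** P ** dagger Fa - T ** R ** dagger Fa - R ** W ** N ** dagger W)"
    unfolding DHa by (simp add: D_def matrix_ring_simps)
  \<comment> \<open>Inserting \<open>G ** dagger Ga\<close> with both signs exhibits the difference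
    of the left sides of \<open>one\<close> and \<open>two\<close>.\<close>
  also have "\<dots> = (F ** R ** P + R ** P ** dagger Fa + G ** dagger Ga - R ** W ** N ** dagger W)
      - (F ** T ** R + T ** R ** dagger Fa + G ** dagger Ga)"
    by (simp add: algebra_simps)
  finally have "F ** D + D ** dagger A = 0" by (simp add: one two)
  then have "D = 0"
    by (rule sylvester_trivial_kernel) (use lyapunov_eigenvalue[OF T(1,2)] \<open>hurwitz A\<close> in auto)
  then have "R ** P = T ** R" by (simp add: D_def)
  then have "R ** P ** dagger R = T ** (R ** dagger R)" by (simp add: matrix_mul_assoc)
  then show ?thesis by (simp add: R(1))
qed

section \<open>Doubled-up matrices of annihilation operator only systems\<close>

lemma mconj_zero [simp]: "mconj 0 = 0"
  by (simp add: vec_eq_iff mconj_def)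

lemma Delta_zero_mult: "Delta X 0 ** Delta Y 0 = Delta (X ** Y) 0"
proof -
  have "mconj X ** mconj Y = mconj (X ** Y)"
    by (simp add: vec_eq_iff mconj_def matrix_matrix_mult_def cnj_sum)
  then show ?thesis by (simp add: Delta_def block_mat_mult)
qed

lemma Delta_zero_add: "Delta X 0 + Delta Y 0 = Delta (X + Y) 0"
  by (simp add: Delta_def block_mat_def mconj_def vec_eq_iff split_sum_all)

lemma Delta_zero_minus: "Delta (- X) 0 = - Delta X 0"
  by (simp add: Delta_def block_mat_def mconj_def vec_eq_iff split_sum_all)

lemma Delta_zero_zero: "Delta 0 0 = 0"
  by (simp add: Delta_def block_mat_def mconj_def vec_eq_iff split_sum_all)

lemma Delta_mat_1: "Delta (mat 1) 0 = mat 1"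
  by (simp add: Delta_def block_mat_def mconj_def mat_def vec_eq_iff split_sum_all)

lemma dagger_Delta_zero: "dagger (Delta X 0) = Delta (dagger X) 0"
  by (simp add: Delta_def block_mat_def mconj_def vec_eq_iff split_sum_all)

text \<open>Conjugating the second half of \<open>v\<close> turns the form of \<open>mconj X\<close>
  into the conjugate of the form of \<open>X\<close>. The real part is thus a sum of two values of
  the form of \<open>X\<close>, not both at zero.\<close>

lemma pos_def_Delta_zero:
  assumes X: "pos_def X"
  shows "pos_def (Delta X 0)"
  unfolding pos_def_iff_cdot
proof (intro conjI allI impI)
  show "hermitian (Delta X 0)"
    using X by (simp add: pos_def_def hermitian_def dagger_Delta_zero)
next
  fix v :: "complex^('a + 'a)"
  assume v: "v \<noteq> 0"
  define a where "a = (\<chi> i. v $ Inl i)"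
  define b where "b = (\<chi> i. cnj (v $ Inr i))"
  have "(Delta X 0 *v v) $ Inl i = (X *v a) $ i"
    and "(Delta X 0 *v v) $ Inr i = cnj ((X *v b) $ i)" for i
    by (simp_all add: Delta_def block_mat_def mconj_def matrix_vector_mult_def sum_sum_type
        a_def b_def cnj_sum)
  then have "cdot v (Delta X 0 *v v) = cdot a (X *v a) + cnj (cdot b (X *v b))"
    by (simp add: cdot_def sum_sum_type a_def b_def cnj_sum)
  then have eq: "Re (cdot v (Delta X 0 *v v)) = Re (cdot a (X *v a)) + Re (cdot b (X *v b))"
    by simp
  have pos: "0 < Re (cdot u (X *v u))" if "u \<noteq> 0" for u
    using X that by (simp add: pos_def_iff_cdot)
  then have nonneg: "0 \<le> Re (cdot u (X *v u))" for u
    by (cases "u = 0") (auto simp: cdot_def less_imp_le)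
  have "a \<noteq> 0 \<or> b \<noteq> 0"
    using v by (auto simp: a_def b_def vec_eq_iff split_sum_all)
  then show "0 < Re (cdot v (Delta X 0 *v v))"
    unfolding eq using pos nonneg by (auto intro: add_pos_nonneg add_nonneg_pos)
qed

text \<open>The inverse is the real scalar matrix \<open>mat 2\<close>. This supplies the symmetry
  of the measurement weight for every choice of angles.\<close>

lemma dagger_inv_homodyne:
  fixes \<theta> :: "real^'m"
  shows "dagger (matrix_inv (homodyne \<theta> ** dagger (homodyne \<theta>))) =
   matrix_inv (homodyne \<theta> ** dagger (homodyne \<theta>))"
proof -
  have "matrix_inv (mat (1/2) :: complex^'m^'m) = mat 2"
    by (rule matrix_inv_unique)
      (simp add: vec_eq_iff matrix_matrix_mult_def mat_def if_distrib[of "\<lambda>x. x * _"] cong: if_cong)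
  then show ?thesis by (simp add: homodyne_mult_dagger)
qed

section \<open>Equality of the two costs\<close>

theorem theorem4p1:
  fixes F1 :: "complex^'n^'n" and G1 :: "complex^'m^'n"
    and H1 :: "complex^'n^'m" and K1 :: "complex^'m^'m"
    and Fc1 Fc2 :: "complex^'k^'k" and Gc1 Gc2 :: "complex^'m^'k"
    and Hc1 Hc2 :: "complex^'k^'m" and Kc1 Kc2 :: "complex^'m^'m"
    and C :: "complex^('n + 'n)^1"
    and \<theta> \<theta>' :: "real^'m"
    and Jc Jc' :: "complex^1^1"
  assumes plant: "physically_realizable_annihilation F1 G1 H1 K1"
    and F: "F = Delta F1 0" and G: "G = Delta G1 0"
    and H: "H = Delta H1 0" and K: "K = Delta K1 0"
    and Fc: "Fc = Delta Fc1 Fc2" and Gc: "Gc = Delta Gc1 Gc2"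
    and Hc: "Hc = Delta Hc1 Hc2" and Kc: "Kc = Delta Kc1 Kc2"
    and Kc_id: "Kc = mat 1"
    and Jc: "purely_classical_cost F G H K C \<theta> Jc"
    and Jc': "coherent_classical_cost F G H K Fc Gc Hc Kc C \<theta>' Jc'"
  shows "Jc' = Jc"
proof -
  obtain T1 where T1: "pos_def T1" "F1 ** T1 + T1 ** dagger F1 + G1 ** dagger G1 = 0"
      "G1 = - (T1 ** dagger H1)" "K1 = mat 1"
    using plant by (auto simp: physically_realizable_annihilation_def)
  define T where "T = Delta T1 0"
  have T: "pos_def T" "F ** T + T ** dagger F + G ** dagger G = 0" "G = - (T ** dagger H)"
  proof -
    show "pos_def T" unfolding T_def by (rule pos_def_Delta_zero[OF T1(1)])
    show "F ** T + T ** dagger F + G ** dagger G = 0"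
      by (simp add: F G T_def dagger_Delta_zero Delta_zero_mult Delta_zero_add T1(2) Delta_zero_zero)
    show "G = - (T ** dagger H)"
      by (simp add: G H T_def dagger_Delta_zero Delta_zero_mult T1(3) Delta_zero_minus)
  qed
  have K_id: "K = mat 1" by (simp add: K T1(4) Delta_mat_1)
  obtain P where P: "kalman_solution F G H (mat 1) (homodyne \<theta>) P" and J: "Jc = C ** P ** dagger C"
    using Jc by (auto simp: purely_classical_cost_def K_id)
  \<comment> \<open>The purely classical scheme is the compression with
    \<open>R = mat 1\<close>.\<close>
  have "mat 1 ** P ** dagger (mat 1) = T"
    by (rule kalman_solution_compression[OF T _ _ _ _ _ dagger_inv_homodyne P]) simp_all
  then have "Jc = C ** T ** dagger C" by (simp add: J)
  moreover
  define R :: "complex^(('n + 'n) + ('k + 'k))^('n + 'n)" where "R = hcat (mat 1) 0"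
  have dR: "dagger R = vcat (mat 1) 0" by (simp add: R_def dagger_hcat)
  obtain P' where P': "kalman_solution (block_mat F 0 (Gc ** H) Fc) (vcat G Gc)
      (hcat H Hc) (mat 1) (homodyne \<theta>') P'" and J': "Jc' = hcat C 0 ** P' ** dagger (hcat C 0)"
    using Jc' by (auto simp: coherent_classical_cost_def K_id Kc_id)
  have "R ** P' ** dagger R = T"
  proof (rule kalman_solution_compression[OF T _ _ _ _ _ dagger_inv_homodyne P'])
    show "block_mat F 0 (Gc ** H) Fc ** dagger R = dagger R ** F + (vcat G Gc - dagger R ** G) ** H"
      by (simp add: dR block_mat_def vcat_mult hcat_mult_vcat vcat_diff vcat_add)
  qed (simp_all add: dR, simp_all add: R_def block_mat_def hcat_mult_vcat mult_hcat)
  then have "C ** (R ** P' ** dagger R) ** dagger C = C ** T ** dagger C" by simp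
  \<comment> \<open>The coherent cost therefore sees \<open>P'\<close> only through its compression
    \<open>R ** P' ** dagger R\<close>, which is the same \<open>T\<close>.\<close>
  moreover have "hcat C 0 = C ** R" by (simp add: R_def mult_hcat)
  ultimately show ?thesis by (simp add: J' dagger_mult matrix_mul_assoc)
qed

end
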